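(* There exists a first countable, locally compact, scattered topological space of cardinality $\omega_1$ which has property $P_{<\omega}$.
   Context: For a natural number $n\ge 1$, a topological space $X$ has property $P_n$ if it is Hausdorff and, whenever $U_0,\dots,U_{n-1}$ are open subsets of $X$ with $\bigcap_{i<n}U_i=\emptyset$, we have $|U_i|\le\omega$ for some $i<n$. A space has property $P_{<\omega}$ if it has property $P_n$ for every $n<\omega$. A space is scattered if every nonempty subspace has an isolated point. *)

theory Defs
  imports "HOL-Analysis.Analysis"
begin

unbundle cardinal_syntax

text \<open>The first uncountable cardinal is \<open>cardSuc natLeq\<close>, a well-order whose field lies in the type
  \<open>nat set\<close>. Hence every space of that cardinality has a homeomorphic copy of type
  \<open>nat set topology\<close>.\<close>

definition scattered_space :: "'a topology \<Rightarrow> bool" where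
  "scattered_space X \<longleftrightarrow>
    (\<forall>S. S \<subseteq> topspace X \<and> S \<noteq> {} \<longrightarrow> (\<exists>x\<in>S. openin (subtopology X S) {x}))"

text \<open>Meaningful only for \<open>n \<ge> 1\<close>: at \<open>n = 0\<close> the indexed intersection is \<open>UNIV\<close>.\<close>

definition property_P :: "nat \<Rightarrow> 'a topology \<Rightarrow> bool" where
  "property_P n X \<longleftrightarrow> Hausdorff_space X \<and>
    (\<forall>U :: nat \<Rightarrow> 'a set.
      (\<forall>i<n. openin X (U i)) \<and> (\<Inter>i<n. U i) = {} \<longrightarrow> (\<exists>i<n. countable (U i)))"

definition property_P_less_omega :: "'a topology \<Rightarrow> bool" where
  "property_P_less_omega X \<longleftrightarrow> (\<forall>n\<ge>1. property_P n X)"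

end

theory Submission
  imports Defs
begin

text \<open>
  The space lives on \<open>\<omega>\<^sub>1 \<times> \<omega>\<close>, with countable levels. A point \<open>x\<close> gets a compact open
  neighbourhood \<open>cell C x\<close> consisting of \<open>x\<close> and a clopen subset of the countable space formed by
  the lower levels, and the sets \<open>nbhd C x F\<close>, with \<open>F\<close> finite and below \<open>x\<close>, form a neighbourhood
  base at \<open>x\<close>.

  The aim is that two uncountable open sets \<open>U\<close>, \<open>V\<close> have an uncountable intersection;
  \<open>P\<^sub>n\<close> then follows by induction on \<open>n\<close>. Two conditions on the neighbourhoods achieve this. First, every
  neighbourhood of a point meets all lower levels, so that \<open>V\<close>, being unbounded, meets every
  level. Second, a Luzin-type condition at limit levels \<open>\<gamma>\<close>: for fixed \<open>m\<close>, \<open>i\<close> and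
  \<open>\<xi> < \<gamma>\<close>, each neighbourhood of a point of level \<open>\<gamma>\<close> meets, above level \<open>\<xi>\<close>, the \<open>m\<close>-th
  basic neighbourhood of every \<open>\<beta>\<close> with second coordinate \<open>i\<close> whose level is below \<open>\<gamma>\<close> and
  sufficiently large. By the pigeonhole principle \<open>U\<close> contains the \<open>m\<close>-th neighbourhood of uncountably many
  points with the same second coordinate \<open>i\<close>; now choose \<open>\<gamma>\<close> as a limit of their levels.

  The Luzin condition can be met by a recursion of length \<open>\<omega>\<^sub>1\<close> without any enumeration of
  uncountable sets, because every cell contains only finitely many points with a given second
  coordinate: each of the countably many compact pieces into which the lower levels are cut has
  only finitely many requirements to be met.
\<close>

section \<open>Cells, neighbourhoods and admissible levels\<close>

definition below :: "'w::wellorder \<Rightarrow> ('w \<times> nat) set" where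
  "below \<gamma> = {x. fst x < \<gamma>}"

text \<open>An increasing chain of finite sets that exhausts the lower levels when these are
  countable. It is cofinal among the finite sets \<open>F\<close> used in \<open>nbhd\<close> and so
  yields countable neighbourhood bases.\<close>

definition initial :: "'w::wellorder \<Rightarrow> nat \<Rightarrow> ('w \<times> nat) set" where
  "initial \<gamma> m = {x \<in> below \<gamma>. to_nat_on (below \<gamma>) x < m}"

definition cell :: "('w \<Rightarrow> nat \<Rightarrow> ('w \<times> nat) set) \<Rightarrow> 'w \<times> nat \<Rightarrow> ('w \<times> nat) set" where
  "cell C x = insert x (C (fst x) (snd x))"

definition cells :: "('w \<Rightarrow> nat \<Rightarrow> ('w \<times> nat) set) \<Rightarrow> ('w \<times> nat) set \<Rightarrow> ('w \<times> nat) set" where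
  "cells C F = (\<Union>x\<in>F. cell C x)"

definition nbhd :: "('w \<Rightarrow> nat \<Rightarrow> ('w \<times> nat) set) \<Rightarrow> 'w \<times> nat \<Rightarrow> ('w \<times> nat) set \<Rightarrow> ('w \<times> nat) set" where
  "nbhd C x F = cell C x - cells C F"

text \<open>A set is clopen iff it is \<open>clopen_at\<close> every point, because \<open>z \<in> nbhd C z F\<close>.\<close>

definition clopen_at :: "('w::wellorder \<Rightarrow> nat \<Rightarrow> ('w \<times> nat) set) \<Rightarrow> ('w \<times> nat) set \<Rightarrow> 'w \<times> nat \<Rightarrow> bool" where
  "clopen_at C A z \<longleftrightarrow>
    (\<exists>F. finite F \<and> F \<subseteq> below (fst z) \<and> (nbhd C z F \<subseteq> A \<or> nbhd C z F \<inter> A = {}))"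

text \<open>The least level qualifies too, vacuously; the limit construction yields empty sets
  there.\<close>

definition limit_level :: "'w::wellorder \<Rightarrow> bool" where
  "limit_level \<gamma> \<longleftrightarrow> (\<forall>\<zeta><\<gamma>. \<exists>\<zeta>'<\<gamma>. \<zeta> < \<zeta>')"

text \<open>The sets \<open>D n\<close> are candidates for the cells of the new points
  \<open>(\<gamma>, n)\<close> without these points themselves. Disjointness separates points of one
  level, clopenness makes the new cells clopen, and finiteness for each second coordinate keeps the
  later requirements finite in number. The last two clauses are the density of each lower level near
  a new point and the Luzin condition.\<close>

definition admissible :: "('w::wellorder \<Rightarrow> nat \<Rightarrow> ('w \<times> nat) set) \<Rightarrow> 'w \<Rightarrow> (nat \<Rightarrow> ('w \<times> nat) set) \<Rightarrow> bool" where
  "admissible C \<gamma> D \<longleftrightarrow>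
    (\<forall>n. D n \<subseteq> below \<gamma>) \<and>
    (\<forall>n n'. n \<noteq> n' \<longrightarrow> D n \<inter> D n' = {}) \<and>
    (\<forall>n. \<forall>z\<in>below \<gamma>. clopen_at C (D n) z) \<and>
    (\<forall>n i. finite {w \<in> D n. snd w = i}) \<and>
    (\<forall>n F \<xi>. finite F \<and> F \<subseteq> below \<gamma> \<and> \<xi> < \<gamma> \<longrightarrow> (\<exists>w \<in> D n - cells C F. fst w = \<xi>)) \<and>
    (limit_level \<gamma> \<longrightarrow> (\<forall>n m i F \<xi>. finite F \<and> F \<subseteq> below \<gamma> \<and> \<xi> < \<gamma> \<longrightarrow>
      (\<exists>\<zeta><\<gamma>. \<forall>\<beta>\<in>below \<gamma>. snd \<beta> = i \<and> \<zeta> \<le> fst \<beta> \<longrightarrow>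
        (\<exists>w \<in> nbhd C \<beta> (initial (fst \<beta>) m) \<inter> D n - cells C F. \<xi> \<le> fst w))))"

lemma admissibleD:
  assumes "admissible C \<gamma> D"
  shows "D n \<subseteq> below \<gamma>"
    and "n \<noteq> n' \<Longrightarrow> D n \<inter> D n' = {}"
    and "z \<in> below \<gamma> \<Longrightarrow> clopen_at C (D n) z"
    and "finite {w \<in> D n. snd w = i}"
    and "finite F \<Longrightarrow> F \<subseteq> below \<gamma> \<Longrightarrow> \<xi> < \<gamma> \<Longrightarrow> \<exists>w \<in> D n - cells C F. fst w = \<xi>"
    and "limit_level \<gamma> \<Longrightarrow> finite F \<Longrightarrow> F \<subseteq> below \<gamma> \<Longrightarrow> \<xi> < \<gamma> \<Longrightarrow>
      \<exists>\<zeta><\<gamma>. \<forall>\<beta>\<in>below \<gamma>. snd \<beta> = i \<and> \<zeta> \<le> fst \<beta> \<longrightarrow>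
        (\<exists>w \<in> nbhd C \<beta> (initial (fst \<beta>) m) \<inter> D n - cells C F. \<xi> \<le> fst w)"
  using assms unfolding admissible_def by simp_all

lemma initial_subset: "initial \<gamma> m \<subseteq> below \<gamma>"
  by (auto simp: initial_def)

lemma initial_mono: "m \<le> m' \<Longrightarrow> initial \<gamma> m \<subseteq> initial \<gamma> m'"
  by (auto simp: initial_def)

lemma initial_0 [simp]: "initial \<gamma> 0 = {}"
  by (auto simp: initial_def)

lemma finite_initial:
  assumes "countable (below \<gamma>)"
  shows "finite (initial \<gamma> m)"
proof (rule inj_on_finite[of "to_nat_on (below \<gamma>)" _ "{..<m}"])
  show "inj_on (to_nat_on (below \<gamma>)) (initial \<gamma> m)"
    using inj_on_subset[OF inj_on_to_nat_on[OF assms] initial_subset] .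
qed (auto simp: initial_def)

lemma finite_subset_initial:
  assumes "finite F" "F \<subseteq> below \<gamma>"
  obtains m where "F \<subseteq> initial \<gamma> m"
proof
  show "F \<subseteq> initial \<gamma> (Suc (Max (to_nat_on (below \<gamma>) ` F)))"
    using assms by (auto simp: initial_def less_Suc_eq_le)
qed

lemma cells_mono: "F \<subseteq> G \<Longrightarrow> cells C F \<subseteq> cells C G"
  by (auto simp: cells_def)

lemma cells_Un: "cells C (F \<union> G) = cells C F \<union> cells C G"
  by (auto simp: cells_def)

lemma cell_self [simp]: "x \<in> cell C x"
  by (simp add: cell_def)

lemma subset_cells: "F \<subseteq> cells C F"
  by (auto simp: cells_def)

lemma nbhd_antimono: "F \<subseteq> G \<Longrightarrow> nbhd C x G \<subseteq> nbhd C x F"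
  by (auto simp: nbhd_def cells_def)

section \<open>The algebra of clopen sets\<close>

lemma clopen_atI:
  assumes "finite F" "F \<subseteq> below (fst z)" "nbhd C z F \<subseteq> A \<or> nbhd C z F \<inter> A = {}"
  shows "clopen_at C A z"
  using assms unfolding clopen_at_def by blast

lemma clopen_at_empty [simp]: "clopen_at C {} z"
  by (rule clopen_atI[of "{}"]) auto

lemma clopen_at_Compl:
  assumes "clopen_at C A z"
  shows "clopen_at C (- A) z"
proof -
  obtain F where "finite F" "F \<subseteq> below (fst z)" "nbhd C z F \<subseteq> A \<or> nbhd C z F \<inter> A = {}"
    using assms unfolding clopen_at_def by blast
  then show ?thesis by (intro clopen_atI[of F]) auto
qed

lemma clopen_at_Int:
  assumes "clopen_at C A z" "clopen_at C B z"
  shows "clopen_at C (A \<inter> B) z"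
proof -
  obtain F where F: "finite F" "F \<subseteq> below (fst z)" "nbhd C z F \<subseteq> A \<or> nbhd C z F \<inter> A = {}"
    using assms unfolding clopen_at_def by blast
  obtain G where G: "finite G" "G \<subseteq> below (fst z)" "nbhd C z G \<subseteq> B \<or> nbhd C z G \<inter> B = {}"
    using assms unfolding clopen_at_def by blast
  have "nbhd C z (F \<union> G) \<subseteq> nbhd C z F" "nbhd C z (F \<union> G) \<subseteq> nbhd C z G"
    by (intro nbhd_antimono; blast)+
  then have "nbhd C z (F \<union> G) \<subseteq> A \<inter> B \<or> nbhd C z (F \<union> G) \<inter> (A \<inter> B) = {}"
    using F(3) G(3) by blast
  then show ?thesis using F(1,2) G(1,2) by (intro clopen_atI[of "F \<union> G"]) auto
qed

lemma clopen_at_Diff: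
  assumes "clopen_at C A z" "clopen_at C B z"
  shows "clopen_at C (A - B) z"
  unfolding Diff_eq by (intro clopen_at_Int clopen_at_Compl assms)

lemma clopen_at_Un:
  assumes "clopen_at C A z" "clopen_at C B z"
  shows "clopen_at C (A \<union> B) z"
proof -
  have "A \<union> B = - (- A \<inter> - B)" by blast
  then show ?thesis by (metis assms clopen_at_Compl clopen_at_Int)
qed

lemma clopen_at_UN:
  assumes "finite J" "\<And>j. j \<in> J \<Longrightarrow> clopen_at C (A j) z"
  shows "clopen_at C (\<Union>j\<in>J. A j) z"
  using assms by (induction J) (auto intro: clopen_at_Un)

text \<open>All neighbourhoods tested at \<open>z\<close> lie inside \<open>cell C z\<close>, so the
  trace on that cell decides. This reduces locally finite unions to finite ones.\<close>

lemma clopen_at_cong: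
  assumes "clopen_at C A z" "A \<inter> cell C z = B \<inter> cell C z"
  shows "clopen_at C B z"
proof -
  obtain F where "finite F" "F \<subseteq> below (fst z)" "nbhd C z F \<subseteq> A \<or> nbhd C z F \<inter> A = {}"
    using assms unfolding clopen_at_def by blast
  moreover have "nbhd C z F \<subseteq> cell C z" by (auto simp: nbhd_def)
  ultimately show ?thesis using assms(2) by (intro clopen_atI[of F]; blast)
qed

section \<open>Towers whose levels are admissible on an initial segment \<open>I\<close>\<close>

locale admissible_tower =
  fixes C :: "'w::wellorder \<Rightarrow> nat \<Rightarrow> ('w \<times> nat) set" and I :: "'w set"
  assumes countable_lessThan: "\<And>\<gamma>::'w. countable {..<\<gamma>}"
    and down: "\<And>\<xi> \<eta>. \<xi> \<in> I \<Longrightarrow> \<eta> < \<xi> \<Longrightarrow> \<eta> \<in> I"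
    and adm: "\<And>\<xi>. \<xi> \<in> I \<Longrightarrow> admissible C \<xi> (C \<xi>)"
begin

lemma countable_below: "countable (below (\<gamma>::'w))"
proof -
  have "below \<gamma> = {..<\<gamma>} \<times> UNIV" by (auto simp: below_def)
  then show ?thesis using countable_lessThan by simp
qed

lemmas finite_initial = finite_initial[OF countable_below]

lemma cell_cases:
  assumes "fst x \<in> I" "w \<in> cell C x"
  shows "w = x \<or> fst w < fst x"
  using admissibleD(1)[OF adm[OF assms(1)], of "snd x"] assms(2) by (auto simp: cell_def below_def)

lemma cell_disjoint:
  assumes "fst x \<in> I" "fst x = fst y" "x \<noteq> y"
  shows "cell C x \<inter> cell C y = {}"
proof -
  have s: "snd x \<noteq> snd y" using assms by (metis prod.collapse)
  have "C (fst x) (snd x) \<inter> C (fst x) (snd y) = {}"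
    by (rule admissibleD(2)[OF adm[OF assms(1)] s])
  moreover have "x \<notin> C (fst x) n" "y \<notin> C (fst x) n" for n
    using admissibleD(1)[OF adm[OF assms(1)], of n] assms(2) by (auto simp: below_def)
  ultimately show ?thesis using assms(2,3) by (auto simp: cell_def)
qed

lemma clopen_at_cell:
  assumes "fst x \<in> I" "fst z \<in> I"
  shows "clopen_at C (cell C x) z"
proof -
  consider "z = x" | "fst z = fst x" "z \<noteq> x" | "fst x < fst z" | "fst z < fst x" by fastforce
  then show ?thesis
  proof cases
    case 1
    then show ?thesis by (intro clopen_atI[of "{}"]) (auto simp: nbhd_def)
  next
    case 2
    then have "cell C z \<inter> cell C x = {}" using assms cell_disjoint by blast
    then show ?thesis by (intro clopen_atI[of "{}"]) (auto simp: nbhd_def)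
  next
    case 3
    \<comment> \<open>As \<open>x\<close> is on a lower level than \<open>z\<close>, its whole cell
      may be cut out of a neighbourhood of \<open>z\<close>.\<close>
    then show ?thesis by (intro clopen_atI[of "{x}"]) (auto simp: nbhd_def below_def cells_def)
  next
    case 4
    then have "clopen_at C (C (fst x) (snd x)) z"
      using admissibleD(3)[OF adm[OF assms(1)]] by (simp add: below_def)
    then show ?thesis
    proof (rule clopen_at_cong)
      have "x \<notin> cell C z" using 4 cell_cases[OF assms(2)] by fastforce
      then show "C (fst x) (snd x) \<inter> cell C z = cell C x \<inter> cell C z"
        by (auto simp: cell_def)
    qed
  qed
qed

lemma clopen_at_cells:
  assumes "finite F" "fst ` F \<subseteq> I" "fst z \<in> I"
  shows "clopen_at C (cells C F) z"
  unfolding cells_def using assms by (intro clopen_at_UN clopen_at_cell) auto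

lemma finite_cell_snd:
  assumes "fst x \<in> I"
  shows "finite {w \<in> cell C x. snd w < k}"
proof -
  have "{w \<in> cell C x. snd w < k} \<subseteq> insert x (\<Union>i<k. {w \<in> C (fst x) (snd x). snd w = i})"
    by (auto simp: cell_def)
  moreover have "finite {w \<in> C (fst x) (snd x). snd w = i}" for i
    by (rule admissibleD(4)[OF adm[OF assms]])
  ultimately show ?thesis by (meson finite.insertI finite_UN finite_lessThan finite_subset)
qed

lemma notin_cells:
  assumes "fst ` F \<subseteq> I" "\<And>y. y \<in> F \<Longrightarrow> y \<noteq> x \<and> fst y \<le> fst x"
  shows "x \<notin> cells C F"
proof
  assume "x \<in> cells C F"
  then obtain y where "y \<in> F" "x \<in> cell C y" by (auto simp: cells_def)
  with assms cell_cases[of y x] show False by fastforce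
qed

text \<open>\<open>A\<close> contains a neighbourhood of \<open>z\<close>, and the density clause
  makes every neighbourhood of \<open>z\<close> meet each lower level.\<close>

lemma ex_fst_in_clopen:
  assumes "fst z \<in> I" "clopen_at C A z" "z \<in> A" "\<xi> < fst z"
  shows "\<exists>w\<in>A. fst w = \<xi>"
proof -
  obtain F where F: "finite F" "F \<subseteq> below (fst z)" "nbhd C z F \<subseteq> A \<or> nbhd C z F \<inter> A = {}"
    using assms unfolding clopen_at_def by blast
  have "z \<notin> cells C F"
    using F(2) down[OF assms(1)] by (intro notin_cells) (fastforce simp: below_def)+
  then have "z \<in> nbhd C z F" by (simp add: nbhd_def)
  then have "nbhd C z F \<subseteq> A" using F(3) assms(3) by blast
  moreover obtain w where "w \<in> C (fst z) (snd z) - cells C F" "fst w = \<xi>"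
    using admissibleD(5)[OF adm[OF assms(1)] F(1,2) assms(4)] by blast
  ultimately show ?thesis by (auto simp: nbhd_def cell_def)
qed

text \<open>If there were only finitely many, cutting out their cells would leave a set that
  contains \<open>z\<close> and is clopen at \<open>z\<close>, which yields one more.\<close>

lemma infinite_fst_in_clopen:
  assumes "fst z \<in> I" "clopen_at C A z" "z \<in> A" "\<xi> < fst z"
  shows "infinite {w\<in>A. fst w = \<xi>}"
proof
  let ?S = "{w\<in>A. fst w = \<xi>}"
  assume fin: "finite ?S"
  have sub: "fst ` ?S \<subseteq> I" using down[OF assms(1)] assms(4) by auto
  have "\<exists>w\<in>A - cells C ?S. fst w = \<xi>"
  proof (rule ex_fst_in_clopen[OF assms(1)])
    show "clopen_at C (A - cells C ?S) z"
      using assms fin sub by (intro clopen_at_Diff clopen_at_cells)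
    have "z \<notin> cells C ?S" using sub assms(4) by (intro notin_cells) auto
    then show "z \<in> A - cells C ?S" using assms(3) by blast
  qed fact
  then show False using subset_cells[of ?S C] by blast
qed

end

section \<open>The recursion step: adding one level\<close>

locale tower_step = admissible_tower C "{..<\<gamma>}" for C :: "'w::wellorder \<Rightarrow> nat \<Rightarrow> ('w \<times> nat) set" and \<gamma>
begin

lemma fst_image_below: "F \<subseteq> below \<gamma> \<Longrightarrow> fst ` F \<subseteq> {..<\<gamma>}"
  by (auto simp: below_def)

lemma cell_subset_below: "x \<in> below \<gamma> \<Longrightarrow> cell C x \<subseteq> below \<gamma>"
proof
  fix w assume "x \<in> below \<gamma>" "w \<in> cell C x"
  then show "w \<in> below \<gamma>" using cell_cases[of x w] by (auto simp: below_def)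
qed

text \<open>The index \<open>r\<close> makes the family of pieces locally finite: if
  \<open>z\<close> is in \<open>initial \<gamma> k\<close>, its cell misses every piece with
  \<open>r x > k\<close>. Likewise the second coordinate \<open>i\<close> occurs only in pieces with
  \<open>r x \<le> i\<close>.\<close>

lemma union_of_pieces:
  fixes J :: "('w \<times> nat) set" and r :: "'w \<times> nat \<Rightarrow> nat" and a
  defines "D \<equiv> \<lambda>n. \<Union>x\<in>J. a x n"
  assumes fin: "\<And>k. finite {x\<in>J. r x \<le> k}"
    and sub: "\<And>x n. x \<in> J \<Longrightarrow> a x n \<subseteq> below \<gamma> - cells C (initial \<gamma> (r x))"
    and clopen: "\<And>x n z. x \<in> J \<Longrightarrow> z \<in> below \<gamma> \<Longrightarrow> clopen_at C (a x n) z"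
    and snd_ge: "\<And>x n w. x \<in> J \<Longrightarrow> w \<in> a x n \<Longrightarrow> r x \<le> snd w"
    and finite_snd: "\<And>x n i. x \<in> J \<Longrightarrow> finite {w \<in> a x n. snd w = i}"
  shows "D n \<subseteq> below \<gamma>" and "z \<in> below \<gamma> \<Longrightarrow> clopen_at C (D n) z" and "finite {w \<in> D n. snd w = i}"
proof -
  show "D n \<subseteq> below \<gamma>" using sub unfolding D_def by blast
  show "finite {w \<in> D n. snd w = i}"
  proof (rule finite_subset)
    show "{w \<in> D n. snd w = i} \<subseteq> (\<Union>x\<in>{x\<in>J. r x \<le> i}. {w \<in> a x n. snd w = i})"
      using snd_ge unfolding D_def by blast
    show "finite (\<Union>x\<in>{x\<in>J. r x \<le> i}. {w \<in> a x n. snd w = i})"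
      using fin[of i] finite_snd by (intro finite_UN_I) auto
  qed
  assume z: "z \<in> below \<gamma>"
  obtain k where k: "z \<in> initial \<gamma> k"
    using finite_subset_initial[of "{z}" \<gamma>] z by auto
  have "clopen_at C (\<Union>x\<in>{x\<in>J. r x \<le> k}. a x n) z"
    using fin clopen[OF _ z] by (intro clopen_at_UN) auto
  then show "clopen_at C (D n) z"
  proof (rule clopen_at_cong)
    have "r x \<le> k" if "x \<in> J" "w \<in> a x n" "w \<in> cell C z" for x w
    proof (rule ccontr)
      assume "\<not> r x \<le> k"
      then have "initial \<gamma> k \<subseteq> initial \<gamma> (r x)" by (intro initial_mono) simp
      then have "w \<in> cells C (initial \<gamma> (r x))" using k that(3) by (auto simp: cells_def)
      then show False using sub that(1,2) by blast
    qed
    then show "(\<Union>x\<in>{x\<in>J. r x \<le> k}. a x n) \<inter> cell C z = D n \<inter> cell C z"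
      unfolding D_def by blast
  qed
qed

text \<open>Here the points of the top level below \<open>\<gamma>\<close> are distributed among the new points.\<close>

lemma successor_step:
  assumes "\<not> limit_level \<gamma>"
  shows "\<exists>D. admissible C \<gamma> D"
proof -
  obtain \<xi> where \<xi>: "\<xi> < \<gamma>" "\<And>\<zeta>. \<zeta> < \<gamma> \<Longrightarrow> \<zeta> \<le> \<xi>"
    using assms unfolding limit_level_def by force
  define J where "J = {x::'w \<times> nat. fst x = \<xi>}"
  \<comment> \<open>Staying below both numbers keeps \<open>x\<close> itself out of
    \<open>F x\<close>. Since each of the two numbers is injective on \<open>J\<close>, bounded
    values of \<open>r\<close> still occur only finitely often.\<close>
  define r where "r x = min (snd x) (to_nat_on (below \<gamma>) x)" for x
  define F where "F x = initial \<gamma> (r x) \<union> {w \<in> cell C x. snd w < r x}" for x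
  \<comment> \<open>Decoding the second coordinate as a pair assigns each \<open>x\<close> to a
    single \<open>n\<close>, and infinitely many \<open>x\<close> to every \<open>n\<close>.\<close>
  define a where "a x n = (if fst (prod_decode (snd x)) = n then cell C x - cells C (F x) else {})" for x n
  define D where "D n = (\<Union>x\<in>J. a x n)" for n
  have Jb: "x \<in> below \<gamma>" if "x \<in> J" for x using that \<xi> by (auto simp: J_def below_def)
  have Fb: "F x \<subseteq> below \<gamma>" if "x \<in> J" for x
    using cell_subset_below[OF Jb[OF that]] initial_subset by (auto simp: F_def)
  have Ff: "finite (F x)" if "x \<in> J" for x
    using finite_initial finite_cell_snd Jb[OF that] by (auto simp: F_def below_def)
  have notin: "x \<notin> cells C G" if "x \<in> J" "G \<subseteq> below \<gamma>" "x \<notin> G" for x G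
  proof (rule notin_cells[OF fst_image_below[OF that(2)]])
    show "y \<noteq> x \<and> fst y \<le> fst x" if "y \<in> G" for y
      using \<open>x \<in> J\<close> \<open>G \<subseteq> below \<gamma>\<close> \<open>x \<notin> G\<close> that \<xi> by (auto simp: J_def below_def)
  qed
  have "finite {x\<in>J. r x \<le> k}" for k
  proof (rule finite_subset)
    show "{x\<in>J. r x \<le> k} \<subseteq> Pair \<xi> ` {..k} \<union> initial \<gamma> (Suc k)"
      using Jb by (auto simp: r_def J_def initial_def min_le_iff_disj less_Suc_eq_le)
  qed (use finite_initial in auto)
  moreover have "a x n \<subseteq> below \<gamma> - cells C (initial \<gamma> (r x))" if "x \<in> J" for x n
    using cell_subset_below[OF Jb[OF that]] by (auto simp: a_def F_def cells_def)
  moreover have "clopen_at C (a x n) z" if "x \<in> J" "z \<in> below \<gamma>" for x n z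
  proof -
    have "clopen_at C (cell C x - cells C (F x)) z"
      using that(2) Ff[OF that(1)] Fb[OF that(1), THEN fst_image_below] Jb[OF that(1)]
      by (intro clopen_at_Diff clopen_at_cell clopen_at_cells) (auto simp: below_def)
    then show ?thesis by (simp add: a_def)
  qed
  moreover have "r x \<le> snd w" if "x \<in> J" "w \<in> a x n" for x n w
  proof (rule ccontr)
    assume "\<not> r x \<le> snd w"
    then have "w \<in> F x" using that(2) by (auto simp: a_def F_def split: if_splits)
    then show False using that(2) subset_cells by (fastforce simp: a_def split: if_splits)
  qed
  moreover have "finite {w \<in> a x n. snd w = i}" if "x \<in> J" for x n i
  proof (rule finite_subset)
    show "{w \<in> a x n. snd w = i} \<subseteq> {w \<in> cell C x. snd w < Suc i}" by (auto simp: a_def)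
  qed (use finite_cell_snd Jb[OF that] in \<open>auto simp: below_def\<close>)
  ultimately have D: "D n \<subseteq> below \<gamma>" "z \<in> below \<gamma> \<Longrightarrow> clopen_at C (D n) z"
    "finite {w \<in> D n. snd w = i}" for n z i
    unfolding D_def by (intro union_of_pieces[where r = r and J = J]; simp)+
  have disj: "D n \<inter> D n' = {}" if "n \<noteq> n'" for n n'
  proof (rule ccontr)
    assume "D n \<inter> D n' \<noteq> {}"
    then obtain x x' w where x: "x \<in> J" "x' \<in> J" "w \<in> a x n" "w \<in> a x' n'" by (auto simp: D_def)
    then have "x \<noteq> x'" "w \<in> cell C x" "w \<in> cell C x'" using that by (auto simp: a_def split: if_splits)
    with cell_disjoint[of x x'] x \<xi>(1) show False by (auto simp: J_def)
  qed
  have rich: "\<exists>w \<in> D n - cells C G. fst w = \<eta>" if G: "finite G" "G \<subseteq> below \<gamma>" and \<eta>: "\<eta> < \<gamma>" for n G \<eta>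
  proof -
    \<comment> \<open>Infinitely many top-level points are assigned to \<open>n\<close>, so one is
      not in \<open>G\<close>; being on the top level, it then avoids \<open>cells C G\<close> as
      well.\<close>
    let ?p = "\<lambda>p. (\<xi>, prod_encode (n, p))"
    have "infinite (range ?p)" by (rule range_inj_infinite) (auto intro: injI)
    then obtain p where p: "?p p \<notin> G" using G(1) by (meson finite_subset image_subset_iff)
    define x where "x = ?p p"
    have x: "x \<in> J" by (simp add: x_def J_def)
    have "x \<notin> F x" by (auto simp: F_def r_def initial_def)
    then have "x \<in> a x n" using notin[OF x Fb[OF x]] by (auto simp: a_def x_def)
    then have xD: "x \<in> D n - cells C G" using x notin[OF x G(2)] p by (auto simp: D_def x_def)
    have "clopen_at C (D n - cells C G) x"
      using D(2) Jb[OF x] G fst_image_below[OF G(2)]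
      by (intro clopen_at_Diff clopen_at_cells) (auto simp: below_def)
    moreover have "fst x = \<xi>" by (simp add: x_def)
    moreover have "\<eta> = \<xi> \<or> \<eta> < \<xi>" using \<xi>(2)[OF \<eta>] by auto
    ultimately show ?thesis
      using xD ex_fst_in_clopen[of x "D n - cells C G" \<eta>] \<xi>(1) by (metis lessThan_iff)
  qed
  show ?thesis
    unfolding admissible_def using D disj rich assms by (intro exI[of _ D]) blast
qed

text \<open>
  The sets \<open>{\<beta>. rk \<beta> = k}\<close> partition the lower levels into compact open pieces. Each \<open>\<beta>\<close> in \<open>J\<close>
  imposes one requirement for every \<open>n\<close>, which is met by a point \<open>f \<beta> n\<close> near \<open>\<beta>\<close>. For fixed \<open>\<beta>\<close> these
  points share one level, so their cells are disjoint, which keeps the sets \<open>D n\<close> disjoint.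
\<close>

lemma limit_step:
  assumes "limit_level \<gamma>"
  shows "\<exists>D. admissible C \<gamma> D"
proof -
  \<comment> \<open>Rank \<open>k\<close> marks the part of
    \<open>cells C (initial \<gamma> (Suc k))\<close> that
    \<open>cells C (initial \<gamma> k)\<close> does not cover; the shift by one makes ranks start
    at 0.\<close>
  define rk where "rk \<beta> = (LEAST k. \<beta> \<in> cells C (initial \<gamma> (Suc k)))" for \<beta>
  have rk1: "\<beta> \<in> cells C (initial \<gamma> (Suc (rk \<beta>)))" if \<beta>: "\<beta> \<in> below \<gamma>" for \<beta>
  proof -
    obtain k where "{\<beta>} \<subseteq> initial \<gamma> k" by (rule finite_subset_initial[of "{\<beta>}" \<gamma>]) (use \<beta> in auto)
    then have "\<beta> \<in> cells C (initial \<gamma> (Suc k))"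
      using initial_mono[of k "Suc k" \<gamma>] subset_cells[of "initial \<gamma> (Suc k)" C] by auto
    then show ?thesis unfolding rk_def by (rule LeastI)
  qed
  have rk2: "\<beta> \<notin> cells C (initial \<gamma> k)" if "k \<le> rk \<beta>" for \<beta> k
  proof (cases k)
    case (Suc j)
    then show ?thesis using that not_less_Least[of j "\<lambda>k. \<beta> \<in> cells C (initial \<gamma> (Suc k))"]
      by (simp add: rk_def)
  qed (simp add: cells_def)
  have rk_eq: "rk w = k" if "w \<in> cells C (initial \<gamma> (Suc k))" "w \<notin> cells C (initial \<gamma> k)" for w k
  proof (rule antisym)
    show "rk w \<le> k" unfolding rk_def using that(1) by (rule Least_le)
    have "w \<in> below \<gamma>"
      using that(1) cell_subset_below initial_subset by (fastforce simp: cells_def)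
    then have "w \<in> cells C (initial \<gamma> (Suc (rk w)))" by (rule rk1)
    then show "k \<le> rk w"
      using that(2) cells_mono[OF initial_mono, of "Suc (rk w)" k C \<gamma>] by (meson not_less_eq_eq subsetD)
  qed
  define H where "H k = {\<beta> \<in> below \<gamma>. rk \<beta> \<le> k \<and> snd \<beta> \<le> k}" for k
  have finite_H: "finite (H k)" for k
  proof (rule finite_subset)
    show "H k \<subseteq> (\<Union>x\<in>initial \<gamma> (Suc k). {w \<in> cell C x. snd w < Suc k})"
    proof
      fix \<beta> assume \<beta>: "\<beta> \<in> H k"
      then have "\<beta> \<in> cells C (initial \<gamma> (Suc (rk \<beta>)))" using rk1 by (simp add: H_def)
      then have "\<beta> \<in> cells C (initial \<gamma> (Suc k))"
        using \<beta> cells_mono[OF initial_mono, of "Suc (rk \<beta>)" "Suc k" C \<gamma>] by (auto simp: H_def)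
      then show "\<beta> \<in> (\<Union>x\<in>initial \<gamma> (Suc k). {w \<in> cell C x. snd w < Suc k})"
        using \<beta> by (auto simp: cells_def H_def)
    qed
    show "finite (\<Union>x\<in>initial \<gamma> (Suc k). {w \<in> cell C x. snd w < Suc k})"
    proof (intro finite_UN_I finite_initial finite_cell_snd)
      show "fst x \<in> {..<\<gamma>}" if "x \<in> initial \<gamma> (Suc k)" for x
        using that initial_subset[of \<gamma> "Suc k"] by (auto simp: below_def)
    qed
  qed
  \<comment> \<open>The bound on \<open>snd \<beta>\<close> leaves finitely many points in each
    piece. The lower level is needed to hold the points \<open>f \<beta> n\<close>.\<close>
  define J where "J = {\<beta> \<in> below \<gamma>. snd \<beta> \<le> rk \<beta> \<and> (\<exists>\<eta>. \<eta> < fst \<beta>)}"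
  \<comment> \<open>The three parts of \<open>R \<beta>\<close> have different purposes: the first
    keeps \<open>Q \<beta>\<close> inside the piece of \<open>\<beta>\<close>, the second puts it
    into the \<open>m\<close>-th basic neighbourhood of \<open>\<beta>\<close> for all
    \<open>m \<le> rk \<beta>\<close>, and the third separates it from lower members of
    \<open>J\<close> in the same piece.\<close>
  define R where "R \<beta> = initial \<gamma> (rk \<beta>) \<union> initial (fst \<beta>) (rk \<beta>) \<union> {\<beta>' \<in> H (rk \<beta>). fst \<beta>' < fst \<beta>}" for \<beta>
  define Q where "Q \<beta> = cell C \<beta> \<inter> cells C (initial \<gamma> (Suc (rk \<beta>))) - cells C (R \<beta>)" for \<beta>
  have Jb: "\<beta> \<in> below \<gamma>" "fst \<beta> < \<gamma>" if "\<beta> \<in> J" for \<beta> using that by (auto simp: J_def below_def)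
  have R: "finite (R \<beta>)" "R \<beta> \<subseteq> below \<gamma>" if "\<beta> \<in> J" for \<beta>
  proof -
    show "finite (R \<beta>)" using finite_initial finite_H by (auto simp: R_def)
    have "initial (fst \<beta>) (rk \<beta>) \<subseteq> below \<gamma>"
      using initial_subset[of "fst \<beta>" "rk \<beta>"] Jb[OF that] by (auto simp: below_def)
    then show "R \<beta> \<subseteq> below \<gamma>" using initial_subset[of \<gamma> "rk \<beta>"] by (auto simp: R_def H_def)
  qed
  have Q_self: "\<beta> \<in> Q \<beta>" if "\<beta> \<in> J" for \<beta>
  proof -
    have "\<beta> \<notin> cells C (initial (fst \<beta>) (rk \<beta>) \<union> {\<beta>' \<in> H (rk \<beta>). fst \<beta>' < fst \<beta>})"
    proof (rule notin_cells[OF fst_image_below])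
      show "initial (fst \<beta>) (rk \<beta>) \<union> {\<beta>' \<in> H (rk \<beta>). fst \<beta>' < fst \<beta>} \<subseteq> below \<gamma>"
        using R(2)[OF that] by (auto simp: R_def)
      show "y \<noteq> \<beta> \<and> fst y \<le> fst \<beta>"
        if "y \<in> initial (fst \<beta>) (rk \<beta>) \<union> {\<beta>' \<in> H (rk \<beta>). fst \<beta>' < fst \<beta>}" for y
        using that initial_subset[of "fst \<beta>" "rk \<beta>"] by (auto simp: below_def)
    qed
    then have "\<beta> \<notin> cells C (R \<beta>)" using rk2[of "rk \<beta>" \<beta>] by (simp add: R_def cells_Un)
    then show ?thesis using rk1[OF Jb(1)[OF that]] by (simp add: Q_def)
  qed
  have Q_clopen: "clopen_at C (Q \<beta>) z" if "\<beta> \<in> J" "z \<in> below \<gamma>" for \<beta> z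
    unfolding Q_def using that Jb(2) R[OF that(1)] fst_image_below[OF R(2)] finite_initial
      fst_image_below[OF initial_subset]
    by (intro clopen_at_Diff clopen_at_Int clopen_at_cell clopen_at_cells) (auto simp: below_def)
  have Q_rk: "rk w = rk \<beta>" if "w \<in> Q \<beta>" for w \<beta>
    using that by (intro rk_eq) (auto simp: Q_def R_def cells_Un)
  have Q_disj: "Q \<beta> \<inter> Q \<beta>' = {}" if "\<beta> \<in> J" "\<beta>' \<in> J" "\<beta> \<noteq> \<beta>'" for \<beta> \<beta>'
  proof -
    have less: "Q \<beta> \<inter> Q \<beta>' = {}" if "\<beta> \<in> J" "\<beta>' \<in> J" "fst \<beta> < fst \<beta>'" for \<beta> \<beta>'
    proof (rule ccontr)
      assume "Q \<beta> \<inter> Q \<beta>' \<noteq> {}"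
      then obtain w where w: "w \<in> Q \<beta>" "w \<in> Q \<beta>'" by blast
      \<comment> \<open>Both points have the rank of \<open>w\<close>, so the cell of the lower one
        was cut out of \<open>Q \<beta>'\<close>.\<close>
      then have "\<beta> \<in> R \<beta>'" using Q_rk[OF w(1)] Q_rk[OF w(2)] that by (simp add: R_def H_def J_def)
      then show False using w by (auto simp: Q_def cells_def)
    qed
    consider "fst \<beta> < fst \<beta>'" | "fst \<beta>' < fst \<beta>" | "fst \<beta> = fst \<beta>'" by fastforce
    then show ?thesis
    proof cases
      case 3
      then have "cell C \<beta> \<inter> cell C \<beta>' = {}" using cell_disjoint Jb(2) that by blast
      then show ?thesis by (auto simp: Q_def)
    qed (use less that in blast)+
  qed
  have "\<exists>f. inj f \<and> (\<forall>n::nat. f n \<in> Q \<beta> \<and> rk \<beta> \<le> snd (f n) \<and> fst (f n) < fst \<beta>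
      \<and> (\<forall>\<xi><fst \<beta>. (\<xi>, 0) \<in> initial \<gamma> (rk \<beta>) \<longrightarrow> \<xi> \<le> fst (f n)) \<and> fst (f n) = fst (f 0))"
    if \<beta>: "\<beta> \<in> J" for \<beta>
  proof -
    obtain \<eta>0 where \<eta>0: "\<eta>0 < fst \<beta>" using \<beta> by (auto simp: J_def)
    \<comment> \<open>The common level of the new points is to dominate all levels below that of
      \<open>\<beta>\<close> that occur in \<open>initial \<gamma> (rk \<beta>)\<close>; as the rank
      grows, they pass any given \<open>\<xi>\<close>. The element \<open>\<eta>0\<close> keeps the
      set nonempty.\<close>
    define S where "S = insert \<eta>0 {\<xi> \<in> fst ` initial \<gamma> (rk \<beta>). \<xi> < fst \<beta>}"
    have S: "finite S" "S \<noteq> {}" using finite_initial by (auto simp: S_def)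
    define \<eta> where "\<eta> = Max S"
    have \<eta>: "\<eta> < fst \<beta>" using Max_in[OF S] \<eta>0 by (auto simp: S_def \<eta>_def)
    have "infinite {w\<in>Q \<beta>. fst w = \<eta>}"
      using infinite_fst_in_clopen[of \<beta> "Q \<beta>" \<eta>] Q_clopen[OF \<beta> Jb(1)[OF \<beta>]] Q_self[OF \<beta>] \<eta> Jb(2)[OF \<beta>] by auto
    moreover have "finite {w \<in> cell C \<beta>. snd w < rk \<beta>}" using finite_cell_snd Jb(2)[OF \<beta>] by simp
    ultimately have "infinite ({w\<in>Q \<beta>. fst w = \<eta>} - {w \<in> cell C \<beta>. snd w < rk \<beta>})" by (rule Diff_infinite_finite[rotated])
    then obtain f :: "nat \<Rightarrow> 'w \<times> nat" where f: "inj f" "range f \<subseteq> {w\<in>Q \<beta>. fst w = \<eta>} - {w \<in> cell C \<beta>. snd w < rk \<beta>}"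
      using infinite_countable_subset by blast
    have "f n \<in> Q \<beta> \<and> rk \<beta> \<le> snd (f n) \<and> fst (f n) = \<eta>" for n
    proof -
      have "f n \<in> {w\<in>Q \<beta>. fst w = \<eta>} - {w \<in> cell C \<beta>. snd w < rk \<beta>}" using f(2) by blast
      then show ?thesis by (auto simp: Q_def)
    qed
    moreover have "\<xi> \<le> \<eta>" if "\<xi> < fst \<beta>" "(\<xi>, 0) \<in> initial \<gamma> (rk \<beta>)" for \<xi>
      unfolding \<eta>_def using S(1) that by (intro Max_ge) (force simp: S_def)+
    ultimately show ?thesis using f(1) \<eta> by (intro exI[of _ f]) simp
  qed
  then obtain f where f: "\<And>\<beta>. \<beta> \<in> J \<Longrightarrow> inj (f \<beta>) \<and> (\<forall>n::nat. f \<beta> n \<in> Q \<beta> \<and> rk \<beta> \<le> snd (f \<beta> n) \<and> fst (f \<beta> n) < fst \<beta>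
      \<and> (\<forall>\<xi><fst \<beta>. (\<xi>, 0) \<in> initial \<gamma> (rk \<beta>) \<longrightarrow> \<xi> \<le> fst (f \<beta> n)) \<and> fst (f \<beta> n) = fst (f \<beta> 0))"
    by metis
  \<comment> \<open>Removing the points with second coordinate below the rank lets each second
    coordinate occur in only finitely many of the sets \<open>a \<beta> n\<close>, for fixed
    \<open>n\<close>.\<close>
  define F where "F \<beta> n = {w \<in> cell C (f \<beta> n). snd w < rk \<beta>}" for \<beta> n
  define a where "a \<beta> n = cell C (f \<beta> n) \<inter> Q \<beta> - cells C (F \<beta> n)" for \<beta> n
  define D where "D n = (\<Union>\<beta>\<in>J. a \<beta> n)" for n
  have fb: "fst (f \<beta> n) < \<gamma>" "f \<beta> n \<in> below \<gamma>" if "\<beta> \<in> J" for \<beta> n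
    using f[OF that] Jb(2)[OF that] by (auto simp: below_def intro: less_trans)
  have F: "finite (F \<beta> n)" "F \<beta> n \<subseteq> below \<gamma>" if "\<beta> \<in> J" for \<beta> n
    using finite_cell_snd[of "f \<beta> n"] fb(1)[OF that, of n] cell_subset_below[OF fb(2)[OF that]]
    unfolding F_def by blast+
  have fa: "f \<beta> n \<in> a \<beta> n" if "\<beta> \<in> J" for \<beta> n
  proof -
    have "f \<beta> n \<notin> cells C (F \<beta> n)"
    proof (rule notin_cells[OF fst_image_below[OF F(2)[OF that]]])
      fix y assume "y \<in> F \<beta> n"
      then have y: "y \<in> cell C (f \<beta> n)" "snd y < rk \<beta>" by (auto simp: F_def)
      then have "y \<noteq> f \<beta> n" using f[OF that] by (metis not_le)
      then show "y \<noteq> f \<beta> n \<and> fst y \<le> fst (f \<beta> n)" using cell_cases[of "f \<beta> n" y] fb(1)[OF that] y(1) by auto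
    qed
    then show ?thesis using f[OF that] by (simp add: a_def)
  qed
  have "finite {\<beta>\<in>J. rk \<beta> \<le> k}" for k
    by (rule finite_subset[OF _ finite_H[of k]]) (auto simp: J_def H_def)
  moreover have "a \<beta> n \<subseteq> below \<gamma> - cells C (initial \<gamma> (rk \<beta>))" if "\<beta> \<in> J" for \<beta> n
    using cell_subset_below[OF fb(2)[OF that]] by (auto simp: a_def Q_def R_def cells_Un)
  moreover have "clopen_at C (a \<beta> n) z" if "\<beta> \<in> J" "z \<in> below \<gamma>" for \<beta> n z
    unfolding a_def using that fb(1)[OF that(1)] F[OF that(1)] fst_image_below[OF F(2)[OF that(1)]] Q_clopen[OF that]
    by (intro clopen_at_Diff clopen_at_Int clopen_at_cell clopen_at_cells) (auto simp: below_def)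
  moreover have "rk \<beta> \<le> snd w" if "\<beta> \<in> J" "w \<in> a \<beta> n" for \<beta> n w
  proof (rule ccontr)
    assume "\<not> rk \<beta> \<le> snd w"
    then have "w \<in> F \<beta> n" using that(2) by (auto simp: a_def F_def)
    then show False using that(2) subset_cells[of "F \<beta> n" C] by (auto simp: a_def)
  qed
  moreover have "finite {w \<in> a \<beta> n. snd w = i}" if "\<beta> \<in> J" for \<beta> n i
  proof (rule finite_subset)
    show "{w \<in> a \<beta> n. snd w = i} \<subseteq> {w \<in> cell C (f \<beta> n). snd w < Suc i}" by (auto simp: a_def)
    show "finite {w \<in> cell C (f \<beta> n). snd w < Suc i}" using finite_cell_snd fb(1)[OF that] by simp
  qed
  ultimately have D: "D n \<subseteq> below \<gamma>" "z \<in> below \<gamma> \<Longrightarrow> clopen_at C (D n) z"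
    "finite {w \<in> D n. snd w = i}" for n z i
    unfolding D_def by (intro union_of_pieces[where r = rk and J = J]; simp)+
  have disj: "D n \<inter> D n' = {}" if "n \<noteq> n'" for n n'
  proof (rule ccontr)
    assume "D n \<inter> D n' \<noteq> {}"
    then obtain \<beta> \<beta>' w where w: "\<beta> \<in> J" "\<beta>' \<in> J" "w \<in> a \<beta> n" "w \<in> a \<beta>' n'" by (auto simp: D_def)
    have "\<beta>' = \<beta>" using Q_disj[OF w(1,2)] w(3,4) by (auto simp: a_def)
    moreover have "fst (f \<beta> n) = fst (f \<beta> n')" using f[OF w(1)] by metis
    moreover have "f \<beta> n \<noteq> f \<beta> n'" using f[OF w(1)] that by (auto dest: injD)
    ultimately have "cell C (f \<beta> n) \<inter> cell C (f \<beta>' n') = {}"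
      using cell_disjoint fb(1)[OF w(1)] by auto
    then show False using w(3,4) by (auto simp: a_def)
  qed
  have hit: "\<exists>\<zeta><\<gamma>. \<forall>\<beta>\<in>below \<gamma>. snd \<beta> = i \<and> \<zeta> \<le> fst \<beta> \<longrightarrow>
      (\<exists>w \<in> nbhd C \<beta> (initial (fst \<beta>) m) \<inter> D n - cells C G. \<xi> \<le> fst w)"
    if G: "finite G" "G \<subseteq> below \<gamma>" and \<xi>: "\<xi> < \<gamma>" for n m i G \<xi>
  proof -
    obtain M0 where M0: "insert (\<xi>, 0) G \<subseteq> initial \<gamma> M0"
      by (rule finite_subset_initial[of "insert (\<xi>, 0) G" \<gamma>]) (use G \<xi> in \<open>auto simp: below_def\<close>)
    \<comment> \<open>The construction at a point of rank at least \<open>M\<close> takes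
      \<open>\<xi>\<close>, \<open>G\<close>, \<open>m\<close> and \<open>i\<close> into account.
      All points above level \<open>\<zeta>0\<close> have such a rank, because they lie in no cell
      of a point of \<open>initial \<gamma> M\<close>.\<close>
    define M where "M = max M0 (max m i)"
    have M: "insert (\<xi>, 0) G \<subseteq> initial \<gamma> M" using M0 initial_mono[of M0 M \<gamma>] by (auto simp: M_def)
    define \<zeta>0 where "\<zeta>0 = Max (fst ` initial \<gamma> M)"
    have \<zeta>0: "fst x \<le> \<zeta>0" if "x \<in> initial \<gamma> M" for x
      using that finite_initial unfolding \<zeta>0_def by (intro Max_ge) auto
    have "\<zeta>0 \<in> fst ` initial \<gamma> M" unfolding \<zeta>0_def using M finite_initial by (intro Max_in) auto
    then have "\<zeta>0 < \<gamma>" using initial_subset[of \<gamma> M] by (auto simp: below_def)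
    then obtain \<zeta> where \<zeta>: "\<zeta> < \<gamma>" "\<zeta>0 < \<zeta>" using assms by (auto simp: limit_level_def)
    have "\<exists>w \<in> nbhd C \<beta> (initial (fst \<beta>) m) \<inter> D n - cells C G. \<xi> \<le> fst w"
      if \<beta>: "\<beta> \<in> below \<gamma>" "snd \<beta> = i" "\<zeta> \<le> fst \<beta>" for \<beta>
    proof -
      have lt: "fst x < fst \<beta>" if "x \<in> initial \<gamma> M" for x
        using \<zeta>0[OF that] \<zeta>(2) \<beta>(3) by simp
      have "\<beta> \<notin> cells C (initial \<gamma> M)"
        using lt by (intro notin_cells[OF fst_image_below[OF initial_subset]]) force
      then have "\<not> Suc (rk \<beta>) \<le> M"
        using rk1[OF \<beta>(1)] cells_mono[OF initial_mono, of "Suc (rk \<beta>)" M C \<gamma>] by blast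
      then have k: "M \<le> rk \<beta>" by simp
      have \<xi>\<beta>: "\<xi> < fst \<beta>" using lt[of "(\<xi>, 0)"] M by simp
      then have J: "\<beta> \<in> J" using k \<beta> by (auto simp: J_def M_def)
      have kM: "initial \<gamma> M \<subseteq> initial \<gamma> (rk \<beta>)" using k by (rule initial_mono)
      have "f \<beta> n \<in> Q \<beta>" "f \<beta> n \<in> D n" "\<xi> \<le> fst (f \<beta> n)"
        using f[OF J] fa[OF J] J \<xi>\<beta> kM M by (auto simp: D_def)
      moreover have "initial (fst \<beta>) m \<subseteq> R \<beta>"
        using k initial_mono[of m "rk \<beta>" "fst \<beta>"] by (auto simp: R_def M_def)
      moreover have "G \<subseteq> R \<beta>" using M kM by (auto simp: R_def)
      ultimately have "f \<beta> n \<in> nbhd C \<beta> (initial (fst \<beta>) m) \<inter> D n - cells C G"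
        by (auto simp: Q_def nbhd_def cells_def)
      then show ?thesis using \<open>\<xi> \<le> fst (f \<beta> n)\<close> by blast
    qed
    then show ?thesis using \<zeta>(1) by blast
  qed
  have rich: "\<exists>w \<in> D n - cells C G. fst w = \<xi>" if G: "finite G" "G \<subseteq> below \<gamma>" and \<xi>: "\<xi> < \<gamma>" for n G \<xi>
  proof -
    \<comment> \<open>The Luzin condition for the whole cell of \<open>(\<zeta>, 0)\<close> supplies
      a point of level at least \<open>\<xi>\<close>; density of the lower levels then reaches
      \<open>\<xi>\<close> exactly.\<close>
    obtain \<zeta> where \<zeta>: "\<zeta> < \<gamma>" "\<forall>\<beta>\<in>below \<gamma>. snd \<beta> = 0 \<and> \<zeta> \<le> fst \<beta> \<longrightarrow>
      (\<exists>w \<in> nbhd C \<beta> (initial (fst \<beta>) 0) \<inter> D n - cells C G. \<xi> \<le> fst w)"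
      using hit[OF G \<xi>, of 0 0 n] by blast
    then obtain w where w: "w \<in> D n - cells C G" "\<xi> \<le> fst w"
      by (auto simp: below_def dest!: bspec[of _ _ "(\<zeta>, 0)"])
    have wb: "w \<in> below \<gamma>" using w(1) D(1) by blast
    have "clopen_at C (D n - cells C G) w"
      using D(2) wb G fst_image_below[OF G(2)]
      by (intro clopen_at_Diff clopen_at_cells) (auto simp: below_def)
    then show ?thesis
      using w ex_fst_in_clopen[of w "D n - cells C G" \<xi>] wb by (cases "\<xi> = fst w") (auto simp: below_def)
  qed
  show ?thesis
    unfolding admissible_def using D disj rich hit by (intro exI[of _ D]) simp
qed

end

section \<open>The transfinite recursion\<close>

lemma admissible_cong:
  assumes "\<And>\<xi>. \<xi> < \<gamma> \<Longrightarrow> C \<xi> = C' \<xi>" "admissible C \<gamma> D"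
  shows "admissible C' \<gamma> D"
proof -
  have cell: "cell C x = cell C' x" if "x \<in> below \<gamma>" for x
    using that assms(1) by (simp add: cell_def below_def)
  have cells: "cells C F = cells C' F" if "F \<subseteq> below \<gamma>" for F
    using that cell unfolding cells_def by (intro SUP_cong) auto
  have sub: "F \<subseteq> below \<gamma>" if "F \<subseteq> below (fst z)" "z \<in> below \<gamma>" for F z
    using that by (auto simp: below_def)
  have nbhd: "nbhd C z F = nbhd C' z F" if "z \<in> below \<gamma>" "F \<subseteq> below (fst z)" for z F
    using cell[OF that(1)] cells[OF sub[OF that(2,1)]] by (simp add: nbhd_def)
  have clopen: "clopen_at C' A z" if z: "z \<in> below \<gamma>" and A: "clopen_at C A z" for A z
  proof -
    obtain F where F: "finite F" "F \<subseteq> below (fst z)" "nbhd C z F \<subseteq> A \<or> nbhd C z F \<inter> A = {}"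
      using A unfolding clopen_at_def by blast
    show ?thesis using F nbhd[OF z F(2)] by (intro clopen_atI[of F]) simp_all
  qed
  note D = admissibleD[OF assms(2)]
  have "\<exists>w \<in> D n - cells C' F. fst w = \<xi>" if "finite F" "F \<subseteq> below \<gamma>" "\<xi> < \<gamma>" for n F \<xi>
    using D(5)[OF that] cells[OF that(2)] by simp
  moreover have "\<exists>\<zeta><\<gamma>. \<forall>\<beta>\<in>below \<gamma>. snd \<beta> = i \<and> \<zeta> \<le> fst \<beta> \<longrightarrow>
      (\<exists>w \<in> nbhd C' \<beta> (initial (fst \<beta>) m) \<inter> D n - cells C' F. \<xi> \<le> fst w)"
    if F: "limit_level \<gamma>" "finite F" "F \<subseteq> below \<gamma>" "\<xi> < \<gamma>" for n m i F \<xi>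
  proof -
    obtain \<zeta> where \<zeta>: "\<zeta> < \<gamma>" "\<And>\<beta>. \<beta>\<in>below \<gamma> \<Longrightarrow> snd \<beta> = i \<and> \<zeta> \<le> fst \<beta> \<longrightarrow>
        (\<exists>w \<in> nbhd C \<beta> (initial (fst \<beta>) m) \<inter> D n - cells C F. \<xi> \<le> fst w)"
      using D(6)[OF F, of i m n] by blast
    have "snd \<beta> = i \<and> \<zeta> \<le> fst \<beta> \<longrightarrow>
        (\<exists>w \<in> nbhd C' \<beta> (initial (fst \<beta>) m) \<inter> D n - cells C' F. \<xi> \<le> fst w)" if "\<beta> \<in> below \<gamma>" for \<beta>
      using \<zeta>(2)[OF that] nbhd[OF that initial_subset] cells[OF F(3)] by simp
    then show ?thesis using \<zeta>(1) by blast
  qed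
  ultimately show ?thesis
    unfolding admissible_def using D(1-4) clopen by simp
qed

text \<open>By \<open>admissible_cong\<close> the condition on a new level consults \<open>C\<close>
  only at lower levels, so the levels can be chosen one after another by well-founded
  recursion.\<close>

lemma ex_admissible_tower:
  assumes "\<And>\<gamma>::'w::wellorder. countable {..<\<gamma>}"
  shows "\<exists>C :: 'w \<Rightarrow> nat \<Rightarrow> ('w \<times> nat) set. \<forall>\<gamma>. admissible C \<gamma> (C \<gamma>)"
proof (rule dependent_wf_choice[OF wf])
  fix C C' :: "'w \<Rightarrow> nat \<Rightarrow> ('w \<times> nat) set" and \<gamma> D
  assume "\<And>z. (z, \<gamma>) \<in> {(x, y). x < y} \<Longrightarrow> C z = C' z"
  then show "admissible C \<gamma> D = admissible C' \<gamma> D"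
    using admissible_cong[of \<gamma> C C' D] admissible_cong[of \<gamma> C' C D] by auto
next
  fix C :: "'w \<Rightarrow> nat \<Rightarrow> ('w \<times> nat) set" and \<gamma>
  assume "\<And>\<xi>. (\<xi>, \<gamma>) \<in> {(x, y). x < y} \<Longrightarrow> admissible C \<xi> (C \<xi>)"
  then interpret tower_step C \<gamma> by unfold_locales (use assms in auto)
  show "\<exists>D. admissible C \<gamma> D" using successor_step limit_step by blast
qed

section \<open>The space and its topological properties\<close>

locale tower = admissible_tower C UNIV for C :: "'w::wellorder \<Rightarrow> nat \<Rightarrow> ('w \<times> nat) set" +
  assumes uncountable_levels: "uncountable (UNIV :: 'w set)"
begin

definition X :: "('w \<times> nat) topology" where
  "X = topology (\<lambda>U. \<forall>z\<in>U. \<exists>F. finite F \<and> F \<subseteq> below (fst z) \<and> nbhd C z F \<subseteq> U)"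

lemma openin_X: "openin X U \<longleftrightarrow> (\<forall>z\<in>U. \<exists>F. finite F \<and> F \<subseteq> below (fst z) \<and> nbhd C z F \<subseteq> U)"
proof -
  have "istopology (\<lambda>U. \<forall>z\<in>U. \<exists>F. finite F \<and> F \<subseteq> below (fst z) \<and> nbhd C z F \<subseteq> U)"
    unfolding istopology_def
  proof (intro conjI allI impI ballI)
    fix S T z
    assume S: "\<forall>z\<in>S. \<exists>F. finite F \<and> F \<subseteq> below (fst z) \<and> nbhd C z F \<subseteq> S"
      and T: "\<forall>z\<in>T. \<exists>F. finite F \<and> F \<subseteq> below (fst z) \<and> nbhd C z F \<subseteq> T" and z: "z \<in> S \<inter> T"
    obtain F where F: "finite F" "F \<subseteq> below (fst z)" "nbhd C z F \<subseteq> S" using S z by blast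
    obtain G where G: "finite G" "G \<subseteq> below (fst z)" "nbhd C z G \<subseteq> T" using T z by blast
    have "nbhd C z (F \<union> G) \<subseteq> nbhd C z F" "nbhd C z (F \<union> G) \<subseteq> nbhd C z G"
      by (intro nbhd_antimono; blast)+
    then have "nbhd C z (F \<union> G) \<subseteq> S \<inter> T" using F(3) G(3) by blast
    then show "\<exists>F. finite F \<and> F \<subseteq> below (fst z) \<and> nbhd C z F \<subseteq> S \<inter> T"
      using F(1,2) G(1,2) by (intro exI[of _ "F \<union> G"]) simp
  next
    fix \<K> z
    assume "\<forall>K\<in>\<K>. \<forall>z\<in>K. \<exists>F. finite F \<and> F \<subseteq> below (fst z) \<and> nbhd C z F \<subseteq> K" "z \<in> \<Union> \<K>"
    then show "\<exists>F. finite F \<and> F \<subseteq> below (fst z) \<and> nbhd C z F \<subseteq> \<Union> \<K>"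
      by (meson Sup_upper UnionE order_trans)
  qed
  then show ?thesis by (simp add: X_def topology_inverse')
qed

lemma topspace_X [simp]: "topspace X = UNIV"
proof -
  have "openin X UNIV" unfolding openin_X by blast
  then show ?thesis using openin_subset by blast
qed

lemma self_in_nbhd: "F \<subseteq> below (fst z) \<Longrightarrow> z \<in> nbhd C z F"
  using notin_cells[of F z] by (fastforce simp: nbhd_def below_def)

lemma openin_clopen:
  assumes "\<And>z. clopen_at C A z"
  shows "openin X A"
  unfolding openin_X
proof
  fix z assume z: "z \<in> A"
  obtain F where F: "finite F" "F \<subseteq> below (fst z)" "nbhd C z F \<subseteq> A \<or> nbhd C z F \<inter> A = {}"
    using assms[of z] unfolding clopen_at_def by blast
  then show "\<exists>F. finite F \<and> F \<subseteq> below (fst z) \<and> nbhd C z F \<subseteq> A"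
    using z self_in_nbhd[OF F(2)] by blast
qed

lemma openin_cell: "openin X (cell C x)" and openin_Compl_cell: "openin X (- cell C x)"
  by (simp_all add: openin_clopen clopen_at_cell clopen_at_Compl)

lemma openin_nbhd: "finite F \<Longrightarrow> openin X (nbhd C x F)"
  unfolding nbhd_def by (intro openin_clopen clopen_at_Diff clopen_at_cell clopen_at_cells) auto

lemma openin_clopen_at:
  assumes "openin X U" "z \<in> U"
  shows "clopen_at C U z"
  using assms unfolding openin_X clopen_at_def by blast

text \<open>For two distinct points, the cell of the one whose level is not higher omits the other,
  and cells are clopen.\<close>

lemma Hausdorff_X: "Hausdorff_space X"
proof -
  have sep: "\<exists>U V. openin X U \<and> openin X V \<and> x \<in> U \<and> y \<in> V \<and> disjnt U V"
    if "fst x \<le> fst y" "x \<noteq> y" for x y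
  proof -
    have "y \<notin> cell C x" using cell_cases[of x y] that by auto
    then show ?thesis
      using openin_cell[of x] openin_Compl_cell[of x] by (intro exI[of _ "cell C x"] exI[of _ "- cell C x"]) (simp add: disjnt_def)
  qed
  show ?thesis unfolding Hausdorff_space_def
  proof (intro allI impI)
    fix x y assume "x \<in> topspace X \<and> y \<in> topspace X \<and> x \<noteq> y"
    then show "\<exists>U V. openin X U \<and> openin X V \<and> x \<in> U \<and> y \<in> V \<and> disjnt U V"
      using sep[of x y] sep[of y x] by (metis disjnt_sym linear)
  qed
qed

text \<open>Induction on the level: one member of the cover contains some \<open>nbhd C x F\<close>,
  and the rest of the cell lies in \<open>cells C F\<close>, a finite union of lower cells that are
  compact by induction.\<close>

lemma compactin_cell: "compactin X (cell C x)"
proof (induction "fst x" arbitrary: x rule: less_induct)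
  case less
  have "\<exists>\<F>. finite \<F> \<and> \<F> \<subseteq> \<U> \<and> cell C x \<subseteq> \<Union> \<F>" if \<U>: "Ball \<U> (openin X)" "cell C x \<subseteq> \<Union> \<U>" for \<U>
  proof -
    obtain U where U: "U \<in> \<U>" "x \<in> U" using \<U>(2) cell_self by blast
    have "openin X U" using \<U>(1) U(1) by blast
    then obtain F where F: "finite F" "F \<subseteq> below (fst x)" "nbhd C x F \<subseteq> U"
      using U(2) unfolding openin_X by blast
    have "compactin X (cells C F)"
      unfolding cells_def using F less by (intro compactin_Union) (auto simp: below_def)
    moreover have "closedin X (cell C x)"
      using openin_Compl_cell by (simp add: closedin_def Compl_eq_Diff_UNIV)
    ultimately have "compactin X (cell C x \<inter> cells C F)" by (rule closed_Int_compactin[rotated])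
    moreover have "cell C x \<inter> cells C F \<subseteq> \<Union> \<U>" using \<U>(2) by blast
    ultimately obtain \<F> where "finite \<F>" "\<F> \<subseteq> \<U>" "cell C x \<inter> cells C F \<subseteq> \<Union> \<F>"
      using \<U>(1) unfolding compactin_def by meson
    then show ?thesis
      using U(1) F(3) by (intro exI[of _ "insert U \<F>"]) (auto simp: nbhd_def)
  qed
  then show ?case unfolding compactin_def by auto
qed

lemma locally_compact_X: "locally_compact_space X"
  unfolding locally_compact_space_def using openin_cell compactin_cell cell_self by (meson order_refl)

text \<open>A point of least level in \<open>S\<close> is the only point of \<open>S\<close> in its
  own cell.\<close>

lemma scattered_X: "scattered_space X"
  unfolding scattered_space_def
proof (intro allI impI)
  fix S assume S: "S \<subseteq> topspace X \<and> S \<noteq> {}"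
  then obtain s where "s \<in> S" by blast
  then obtain x where x: "x \<in> S" "\<And>y. (y, x) \<in> inv_image {(a, b). a < b} fst \<Longrightarrow> y \<notin> S"
    by (rule wfE_min[OF wf_inv_image[OF wf, where f = fst]]) blast
  have "cell C x \<inter> S = {x}"
  proof
    show "cell C x \<inter> S \<subseteq> {x}" using x(2) cell_cases[of x] by (auto simp: inv_image_def)
  qed (use x(1) in simp)
  then show "\<exists>x\<in>S. openin (subtopology X S) {x}"
    using x(1) openin_cell[of x] unfolding openin_subtopology by (metis (no_types, lifting))
qed

lemma initial_nbhd:
  assumes "openin X U" "x \<in> U"
  obtains m where "nbhd C x (initial (fst x) m) \<subseteq> U"
proof -
  obtain F where F: "finite F" "F \<subseteq> below (fst x)" "nbhd C x F \<subseteq> U"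
    using assms unfolding openin_X by blast
  obtain m where "F \<subseteq> initial (fst x) m" using finite_subset_initial[OF F(1,2)] .
  then show ?thesis using that nbhd_antimono[of F "initial (fst x) m" C x] F(3) by blast
qed

lemma first_countable_X: "first_countable X"
  unfolding first_countable_def
proof
  fix x
  show "\<exists>\<B>. countable \<B> \<and> (\<forall>V\<in>\<B>. openin X V) \<and>
      (\<forall>U. openin X U \<and> x \<in> U \<longrightarrow> (\<exists>V\<in>\<B>. x \<in> V \<and> V \<subseteq> U))"
  proof (intro exI[of _ "range (\<lambda>m. nbhd C x (initial (fst x) m))"] conjI allI impI)
    fix U assume U: "openin X U \<and> x \<in> U"
    obtain m where "nbhd C x (initial (fst x) m) \<subseteq> U" using initial_nbhd U by blast
    then show "\<exists>V\<in>range (\<lambda>m. nbhd C x (initial (fst x) m)). x \<in> V \<and> V \<subseteq> U"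
      using self_in_nbhd[OF initial_subset] by blast
  qed (auto intro: openin_nbhd finite_initial)
qed

section \<open>Intersections of uncountable open sets\<close>

lemma countable_iff_bounded: "countable A \<longleftrightarrow> (\<exists>\<xi>. A \<subseteq> below \<xi>)" for A :: "('w \<times> nat) set"
proof
  assume "countable A"
  \<comment> \<open>Countably many countable initial segments cannot exhaust the uncountable set of
    levels.\<close>
  then have "countable (\<Union>x\<in>A. {..<fst x} \<union> {fst x})"
    using countable_lessThan by (intro countable_UN) auto
  then obtain \<xi> where "\<xi> \<notin> (\<Union>x\<in>A. {..<fst x} \<union> {fst x})"
    using uncountable_levels by (metis UNIV_eq_I)
  then have "A \<subseteq> below \<xi>" by (force simp: below_def)
  then show "\<exists>\<xi>. A \<subseteq> below \<xi>" ..
next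
  assume "\<exists>\<xi>. A \<subseteq> below \<xi>"
  then obtain \<xi> where "A \<subseteq> below \<xi>" ..
  then show "countable A" using countable_below by (rule countable_subset)
qed

lemma unboundedE:
  fixes A :: "('w \<times> nat) set" and \<xi> :: 'w
  assumes "uncountable A"
  obtains x where "x \<in> A" "\<xi> < fst x"
proof -
  have "{..\<xi>} = insert \<xi> {..<\<xi>}" by auto
  then have "countable {..\<xi>}" using countable_lessThan[of \<xi>] by simp
  then have "countable ({..\<xi>} \<times> (UNIV :: nat set))" by simp
  then have "\<not> A \<subseteq> {..\<xi>} \<times> UNIV"
    using assms countable_subset[of A "{..\<xi>} \<times> UNIV"] by blast
  then obtain x where "x \<in> A" "x \<notin> {..\<xi>} \<times> UNIV" by blast
  then show ?thesis using that[of x] by (cases x) auto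
qed

text \<open>Repeatedly choosing a point of \<open>A\<close> above the current level gives a strictly
  increasing sequence of levels. Being countable, it is bounded, and its supremum is the required
  limit.\<close>

lemma ex_limit_of:
  fixes A :: "('w \<times> nat) set" and \<xi> :: 'w
  assumes "uncountable A"
  obtains \<delta> where "\<xi> < \<delta>" "limit_level \<delta>" "\<And>\<zeta>. \<zeta> < \<delta> \<Longrightarrow> \<exists>x\<in>A. \<zeta> < fst x \<and> fst x < \<delta>"
proof -
  have "\<exists>x\<in>A. \<zeta> < fst x" for \<zeta> using unboundedE[OF assms, of \<zeta>] by blast
  then obtain g where g: "\<And>\<zeta>. g \<zeta> \<in> A" "\<And>\<zeta>. \<zeta> < fst (g \<zeta>)" by metis
  define s where "s k = ((\<lambda>\<zeta>. fst (g \<zeta>)) ^^ k) \<xi>" for k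
  have s: "s k < s (Suc k)" "s (Suc k) = fst (g (s k))" for k by (auto simp: s_def g)
  have "countable (range (\<lambda>k. (s k, 0::nat)))" by simp
  then obtain b where b: "range (\<lambda>k. (s k, 0::nat)) \<subseteq> below b" using countable_iff_bounded by blast
  define \<delta> where "\<delta> = (LEAST b. \<forall>k. s k < b)"
  have "\<forall>k. s k < \<delta>"
    unfolding \<delta>_def by (rule LeastI[of _ b]) (use b in \<open>simp add: below_def image_subset_iff\<close>)
  then have \<delta>: "s k < \<delta>" for k ..
  have cofinal: "\<exists>k. \<zeta> < s k" if \<zeta>: "\<zeta> < \<delta>" for \<zeta>
  proof -
    have "\<not> (\<forall>k. s k < \<zeta>)" using not_less_Least \<zeta> unfolding \<delta>_def by fast
    then obtain k where "\<zeta> \<le> s k" by (auto simp: not_less)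
    then show ?thesis using s(1)[of k] by (intro exI[of _ "Suc k"]) simp
  qed
  show ?thesis
  proof
    show "\<xi> < \<delta>" using \<delta>[of 0] by (simp add: s_def)
    show "limit_level \<delta>" unfolding limit_level_def using cofinal \<delta> by blast
    show "\<exists>x\<in>A. \<zeta> < fst x \<and> fst x < \<delta>" if \<zeta>: "\<zeta> < \<delta>" for \<zeta>
    proof -
      obtain k where k: "\<zeta> < s k" using cofinal[OF \<zeta>] by blast
      then have "\<zeta> < fst (g (s k))" using s[of k] by simp
      then show ?thesis using g(1)[of "s k"] \<delta>[of "Suc k"] s(2)[of k] by auto
    qed
  qed
qed

lemma uncountable_Int:
  assumes U: "openin X U" "uncountable U" and V: "openin X V" "uncountable V"
  shows "uncountable (U \<inter> V)"
proof -
  have "\<exists>w\<in>U \<inter> V. \<xi> \<le> fst w" for \<xi>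
  proof -
    define A where "A m i = {x \<in> U. snd x = i \<and> nbhd C x (initial (fst x) m) \<subseteq> U}" for m i
    have "U \<subseteq> (\<Union>m i. A m i)"
    proof
      fix x assume x: "x \<in> U"
      obtain m where "nbhd C x (initial (fst x) m) \<subseteq> U" using initial_nbhd[OF U(1) x] .
      then show "x \<in> (\<Union>m i. A m i)" using x by (auto simp: A_def)
    qed
    then have "uncountable (\<Union>m i. A m i)" using U(2) countable_subset[of U "\<Union>m i. A m i"] by blast
    then obtain m i where "uncountable (A m i)" by (meson countable_UN countableI_type)
    then obtain \<delta> where \<delta>: "\<xi> < \<delta>" "limit_level \<delta>" "\<And>\<zeta>. \<zeta> < \<delta> \<Longrightarrow> \<exists>x\<in>A m i. \<zeta> < fst x \<and> fst x < \<delta>"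
      using ex_limit_of by blast
    obtain y where y: "y \<in> V" "\<delta> < fst y" using unboundedE[OF V(2)] by blast
    \<comment> \<open>Density brings the unbounded set \<open>V\<close> down to level
      \<open>\<delta>\<close> exactly, where the Luzin condition applies to the cell of
      \<open>v\<close>.\<close>
    obtain v where v: "v \<in> V" "fst v = \<delta>"
      using ex_fst_in_clopen[OF _ openin_clopen_at[OF V(1) y(1)] y] by auto
    obtain F where F: "finite F" "F \<subseteq> below \<delta>" "nbhd C v F \<subseteq> V"
      using V(1) v unfolding openin_X by blast
    obtain \<zeta> where \<zeta>: "\<zeta> < \<delta>" "\<And>\<beta>. \<beta> \<in> below \<delta> \<Longrightarrow> snd \<beta> = i \<and> \<zeta> \<le> fst \<beta> \<longrightarrow>
        (\<exists>w \<in> nbhd C \<beta> (initial (fst \<beta>) m) \<inter> C \<delta> (snd v) - cells C F. \<xi> \<le> fst w)"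
      using admissibleD(6)[OF adm[OF UNIV_I] \<delta>(2) F(1,2) \<delta>(1), of i m "snd v"] by blast
    obtain \<beta> where \<beta>: "\<beta> \<in> A m i" "\<zeta> < fst \<beta>" "fst \<beta> < \<delta>" using \<delta>(3)[OF \<zeta>(1)] by blast
    then obtain w where w: "w \<in> nbhd C \<beta> (initial (fst \<beta>) m)" "w \<in> C \<delta> (snd v)" "w \<notin> cells C F" "\<xi> \<le> fst w"
      using \<zeta>(2)[of \<beta>] by (auto simp: A_def below_def)
    \<comment> \<open>This places \<open>w\<close> in \<open>V\<close>; it is in \<open>U\<close>
      because the chosen neighbourhood of \<open>\<beta>\<close> is contained in
      \<open>U\<close>.\<close>
    have "w \<in> nbhd C v F" using w v by (simp add: nbhd_def cell_def)
    then show ?thesis using w(1,4) \<beta>(1) F(3) by (auto simp: A_def)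
  qed
  then have "\<not> U \<inter> V \<subseteq> below \<xi>" for \<xi>
    unfolding below_def subset_iff mem_Collect_eq not_less[symmetric] by blast
  then show ?thesis unfolding countable_iff_bounded by blast
qed

lemma property_P_X: "property_P n X"
  unfolding property_P_def
proof (intro conjI Hausdorff_X allI impI)
  fix U :: "nat \<Rightarrow> ('w \<times> nat) set"
  assume U: "(\<forall>i<n. openin X (U i)) \<and> (\<Inter>i<n. U i) = {}"
  show "\<exists>i<n. countable (U i)"
  proof (rule ccontr)
    assume unc: "\<not> (\<exists>i<n. countable (U i))"
    \<comment> \<open>Partial intersections stay uncountable, so the full one is nonempty. At
      \<open>k = 0\<close> the intersection is the whole space.\<close>
    have "openin X (\<Inter>i<k. U i) \<and> uncountable (\<Inter>i<k. U i)" if "k \<le> n" for k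
      using that
    proof (induction k)
      case 0
      have "uncountable (UNIV :: ('w \<times> nat) set)"
        using uncountable_levels countable_image[of UNIV fst] by (metis fst_conv surj_def)
      then show ?case using openin_topspace[of X] by simp
    next
      case (Suc k)
      then show ?case
        using U unc uncountable_Int[of "U k" "\<Inter>i<k. U i"] by (simp add: lessThan_Suc openin_Int)
    qed
    from this[of n] U show False by simp
  qed
qed

end

section \<open>The first uncountable cardinal as a well-ordered type\<close>

typedef omega1 = "Field (cardSuc natLeq)"
  using cardSuc_finite[OF natLeq_Card_order] by (metis Field_natLeq finite.emptyI infinite_UNIV_nat ex_in_conv)

instantiation omega1 :: wellorder
begin

definition less_eq_omega1 :: "omega1 \<Rightarrow> omega1 \<Rightarrow> bool" where
  "(a :: omega1) \<le> b \<longleftrightarrow> (Rep_omega1 a, Rep_omega1 b) \<in> cardSuc natLeq"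

definition less_omega1 :: "omega1 \<Rightarrow> omega1 \<Rightarrow> bool" where
  "(a :: omega1) < b \<longleftrightarrow> a \<le> b \<and> a \<noteq> b"

instance
proof -
  have wo: "Well_order (cardSuc natLeq)"
    using cardSuc_Card_order[OF natLeq_Card_order] by (simp add: card_order_on_def)
  then have props: "refl_on (Field (cardSuc natLeq)) (cardSuc natLeq)" "trans (cardSuc natLeq)"
    "antisym (cardSuc natLeq)" "total_on (Field (cardSuc natLeq)) (cardSuc natLeq)" "wf (cardSuc natLeq - Id)"
    by (auto simp: order_on_defs)
  have antisym: "a = b" if "a \<le> b" "b \<le> a" for a b :: omega1
    using antisymD[OF props(3), of "Rep_omega1 a" "Rep_omega1 b"] that
    by (simp add: less_eq_omega1_def Rep_omega1_inject)
  show "OFCLASS(omega1, wellorder_class)"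
  proof (standard, goal_cases)
    case (1 a b)
    then show ?case using antisym by (auto simp: less_omega1_def)
  next
    case (2 a)
    then show ?case using refl_onD[OF props(1)] Rep_omega1 by (simp add: less_eq_omega1_def)
  next
    case (3 a b c)
    then show ?case using transD[OF props(2)] by (auto simp: less_eq_omega1_def)
  next
    case (4 a b)
    then show ?case by (rule antisym)
  next
    case (5 a b)
    then show ?case using props(4) refl_onD[OF props(1)] Rep_omega1
      by (cases "a = b") (auto simp: less_eq_omega1_def total_on_def Rep_omega1_inject)
  next
    case (6 P a)
    have "wf (inv_image (cardSuc natLeq - Id) Rep_omega1)" using props(5) by (rule wf_inv_image)
    then show ?case
      by (rule wf_induct_rule) (use 6 in \<open>auto simp: less_omega1_def less_eq_omega1_def Rep_omega1_inject\<close>)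
  qed
qed

end

lemma countable_iff_ordLeq_natLeq: "countable A \<longleftrightarrow> |A| \<le>o natLeq"
proof
  assume "countable A"
  then have "|A| \<le>o |UNIV :: nat set|" unfolding countable_def card_of_ordLeq[symmetric] by blast
  then show "|A| \<le>o natLeq" using card_of_nat ordLeq_ordIso_trans by blast
next
  assume "|A| \<le>o natLeq"
  then have "|A| \<le>o |UNIV :: nat set|" using card_of_nat ordIso_symmetric ordLeq_ordIso_trans by blast
  then show "countable A" unfolding countable_def card_of_ordLeq[symmetric] by blast
qed

text \<open>A proper initial segment of a cardinal is strictly smaller, which for the successor of
  \<open>natLeq\<close> means at most \<open>natLeq\<close>.\<close>

lemma countable_lessThan_omega1: "countable {..<\<gamma>::omega1}"
proof -
  have "|underS (cardSuc natLeq) (Rep_omega1 \<gamma>)| <o cardSuc natLeq"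
    using card_of_underS[OF cardSuc_Card_order[OF natLeq_Card_order] Rep_omega1] .
  then have "countable (underS (cardSuc natLeq) (Rep_omega1 \<gamma>))"
    unfolding countable_iff_ordLeq_natLeq
    by (rule iffD1[OF cardSuc_ordLeq_ordLess[OF natLeq_Card_order card_of_Card_order]])
  then have "countable (Rep_omega1 ` {..<\<gamma>})"
    by (rule countable_subset[rotated])
      (auto simp: underS_def less_omega1_def less_eq_omega1_def Rep_omega1_inject)
  then show ?thesis by (rule countable_image_inj_on) (simp add: inj_on_def Rep_omega1_inject)
qed

lemma bij_betw_Rep_omega1: "bij_betw Rep_omega1 UNIV (Field (cardSuc natLeq))"
  using type_definition.Rep_range[OF type_definition_omega1]
  by (auto simp: bij_betw_def inj_on_def Rep_omega1_inject)

lemma card_of_Field_cardSuc_natLeq: "|Field (cardSuc natLeq)| =o cardSuc natLeq"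
  by (simp add: card_of_Field_ordIso cardSuc_Card_order natLeq_Card_order)

lemma uncountable_omega1: "uncountable (UNIV :: omega1 set)"
proof
  assume "countable (UNIV :: omega1 set)"
  then have "countable (Field (cardSuc natLeq))"
    using bij_betw_Rep_omega1 countable_image by (metis bij_betw_imp_surj_on)
  then have "cardSuc natLeq \<le>o natLeq"
    using card_of_Field_cardSuc_natLeq ordIso_symmetric ordIso_ordLeq_trans
    unfolding countable_iff_ordLeq_natLeq by blast
  then show False using cardSuc_greater[OF natLeq_Card_order] not_ordLess_ordLeq by blast
qed

text \<open>A nonempty countable factor does not change an infinite cardinality. The bijection
  serves to carry the space over to \<open>nat set\<close>.\<close>

lemma ex_bij_omega1_times_nat:
  "\<exists>g :: omega1 \<times> nat \<Rightarrow> nat set. bij_betw g UNIV (Field (cardSuc natLeq))"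
proof -
  have inf: "infinite (Field (cardSuc natLeq))"
    using uncountable_omega1 bij_betw_Rep_omega1 bij_betw_finite uncountable_infinite by blast
  have "natLeq \<le>o cardSuc natLeq" by (rule cardSuc_ordLeq[OF natLeq_Card_order])
  then have le: "|UNIV :: nat set| \<le>o |Field (cardSuc natLeq)|"
    using card_of_nat card_of_Field_cardSuc_natLeq ordIso_ordLeq_trans ordLeq_ordIso_trans ordIso_symmetric by meson
  have "|Field (cardSuc natLeq) \<times> (UNIV :: nat set)| =o |Field (cardSuc natLeq)|"
    using card_of_Times_infinite[OF inf _ le] by simp
  then obtain h where h: "bij_betw h (Field (cardSuc natLeq) \<times> (UNIV :: nat set)) (Field (cardSuc natLeq))"
    unfolding card_of_ordIso[symmetric] by blast
  have "bij_betw (map_prod Rep_omega1 id) (UNIV \<times> UNIV) (Field (cardSuc natLeq) \<times> (UNIV :: nat set))"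
    by (intro bij_betw_map_prod bij_betw_Rep_omega1 bij_betw_id)
  from bij_betw_trans[OF this h] show ?thesis by auto
qed

section \<open>Transfer along a homeomorphism to the required type\<close>

lemma scattered_space_homeomorphic_image:
  assumes g: "homeomorphic_map X Y g" and X: "scattered_space X"
  shows "scattered_space Y"
  unfolding scattered_space_def
proof (intro allI impI)
  fix S assume S: "S \<subseteq> topspace Y \<and> S \<noteq> {}"
  define T where "T = {x \<in> topspace X. g x \<in> S}"
  have "S \<subseteq> g ` topspace X" using S homeomorphic_imp_surjective_map[OF g] by simp
  then have "T \<noteq> {}" using S by (auto simp: T_def)
  then obtain x where x: "x \<in> T" "openin (subtopology X T) {x}"
    using X unfolding scattered_space_def T_def by (metis (no_types, lifting) mem_Collect_eq subsetI)
  then obtain W where W: "openin X W" "{x} = W \<inter> T" unfolding openin_subtopology by blast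
  have "openin Y (g ` W)" using W(1) homeomorphic_imp_open_map[OF g] by (simp add: open_map_def)
  moreover have "{g x} = g ` W \<inter> S"
    using W x(1) openin_subset[OF W(1)] by (auto simp: T_def)
  ultimately show "\<exists>y\<in>S. openin (subtopology Y S) {y}"
    using x(1) unfolding openin_subtopology T_def by blast
qed

lemma property_P_homeomorphic_image:
  assumes g: "homeomorphic_map X Y g" and X: "property_P n X"
  shows "property_P n Y"
  unfolding property_P_def
proof (intro conjI allI impI)
  show "Hausdorff_space Y"
    using X homeomorphic_Hausdorff_space homeomorphic_map_imp_homeomorphic_space[OF g]
    by (auto simp: property_P_def)
  fix U :: "nat \<Rightarrow> _"
  assume U: "(\<forall>i<n. openin Y (U i)) \<and> (\<Inter>i<n. U i) = {}"
  define V where "V i = {x \<in> topspace X. g x \<in> U i}" for i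
  have "openin X (V i)" if "i < n" for i
    unfolding V_def using U that homeomorphic_imp_continuous_map[OF g] openin_continuous_map_preimage by blast
  moreover have "(\<Inter>i<n. V i) = {}" using U by (fastforce simp: V_def)
  ultimately obtain i where i: "i < n" "countable (V i)" using X unfolding property_P_def by blast
  have "U i \<subseteq> g ` V i"
    using U i(1) openin_subset[of Y "U i"] homeomorphic_imp_surjective_map[OF g] by (auto simp: V_def)
  then have "countable (U i)" using i(2) countable_subset[OF _ countable_image] by blast
  then show "\<exists>i<n. countable (U i)" using i(1) by blast
qed

theorem proposition2p2:
  shows "\<exists>X :: nat set topology.
    first_countable X \<and> locally_compact_space X \<and> scattered_space X \<and>
    |topspace X| =o cardSuc natLeq \<and> property_P_less_omega X"
proof -
  obtain C :: "omega1 \<Rightarrow> nat \<Rightarrow> (omega1 \<times> nat) set" where C: "\<And>\<gamma>. admissible C \<gamma> (C \<gamma>)"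
    using ex_admissible_tower countable_lessThan_omega1 by blast
  interpret tower C
    by unfold_locales (use C countable_lessThan_omega1 uncountable_omega1 in auto)
  obtain g :: "omega1 \<times> nat \<Rightarrow> nat set" where g: "bij_betw g UNIV (Field (cardSuc natLeq))"
    using ex_bij_omega1_times_nat by blast
  then have inj: "inj g" and range: "range g = Field (cardSuc natLeq)" by (auto simp: bij_betw_def)
  \<comment> \<open>Pulling \<open>X\<close> back along the inverse of the injection
    \<open>g\<close> puts a copy of its topology on the range of \<open>g\<close>, so that
    \<open>g\<close> becomes a homeomorphism.\<close>
  define Y where "Y = pullback_topology (range g) (inv g) X"
  have openin_Y: "openin Y S \<longleftrightarrow> (\<exists>U. openin X U \<and> S = g ` U)" for S
  proof -
    have "inv g -` U \<inter> range g = g ` U" for U using inj by auto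
    then show ?thesis by (simp add: Y_def openin_pullback_topology)
  qed
  have topspace_Y: "topspace Y = range g" by (simp add: Y_def topspace_pullback_topology)
  have hom: "homeomorphic_map X Y g"
  proof (rule bijective_open_imp_homeomorphic_map)
    show "continuous_map X Y g"
      unfolding continuous_map_def using inj by (auto simp: topspace_Y openin_Y inj_image_mem_iff)
    show "open_map X Y g" unfolding open_map_def openin_Y by blast
  qed (use inj topspace_Y in auto)
  then have "X homeomorphic_space Y" by (rule homeomorphic_map_imp_homeomorphic_space)
  then have "first_countable Y" "locally_compact_space Y"
    using first_countable_X locally_compact_X homeomorphic_space_first_countability
      homeomorphic_locally_compact_space by blast+
  moreover have "scattered_space Y" using scattered_space_homeomorphic_image[OF hom scattered_X] .
  moreover have "|topspace Y| =o cardSuc natLeq"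
    using card_of_Field_cardSuc_natLeq by (simp add: topspace_Y range)
  moreover have "property_P_less_omega Y"
    unfolding property_P_less_omega_def using property_P_homeomorphic_image[OF hom property_P_X] by blast
  ultimately show ?thesis by blast
qed

end
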